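(* For every $n$-variable bent function $f:\{-1,1\}^n\to\{-1,1\}$, the minimum of $\sum_S|w_S|$ over all integer-coefficient polynomial threshold function representations $p=\sum_S w_S\prod_{k\in S}x_k$ of $f$ having length at most $0.75\times 2^n$ is at most $0.75\times 2^{2n}$. (In particular such representations exist.)
   Context: An $n$-variable Boolean function ($n\ge 1$) is a map $f:\{-1,1\}^n\to\{-1,1\}$. It has a unique expansion $f(x)=\sum_{S\subseteq\{1,\dots,n\}} s_S\prod_{k\in S}x_k$ with real $s_S$; the numbers $2^n s_S$ are its Walsh coefficients. $f$ is called bent if all its Walsh coefficients are $\pm 2^{n/2}$ (bent functions exist only for even $n$). A multilinear polynomial $p(x)=\sum_{S} w_S\prod_{k\in S}x_k$ is a polynomial threshold function (PTF) representation of $f$ if $f(x)=\operatorname{sgn}(p(x))$ for all $x\in\{-1,1\}^n$; in particular $p(x)\neq 0$ for all such $x$. Its length is the number of non-zero coefficients $w_S$. *)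

theory Defs
  imports "HOL-Analysis.Analysis"
begin

definition cube :: "nat \<Rightarrow> (nat \<Rightarrow> real) set" where
  "cube n = {1..n} \<rightarrow>\<^sub>E {-1, 1}"

text \<open>A Boolean function is only constrained on the cube; its values elsewhere are irrelevant.\<close>
definition boolean_function :: "nat \<Rightarrow> ((nat \<Rightarrow> real) \<Rightarrow> real) \<Rightarrow> bool" where
  "boolean_function n f \<longleftrightarrow> f \<in> cube n \<rightarrow> {-1, 1}"

text \<open>A multilinear polynomial in \<open>n\<close> variables is given by its coefficient family, of which
  only the coefficients indexed by subsets of \<open>{1..n}\<close> are used.\<close>
definition mpoly_eval :: "nat \<Rightarrow> (nat set \<Rightarrow> real) \<Rightarrow> (nat \<Rightarrow> real) \<Rightarrow> real" where
  "mpoly_eval n w x = (\<Sum>S\<in>Pow {1..n}. w S * (\<Prod>k\<in>S. x k))"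

definition is_expansion :: "nat \<Rightarrow> ((nat \<Rightarrow> real) \<Rightarrow> real) \<Rightarrow> (nat set \<Rightarrow> real) \<Rightarrow> bool" where
  "is_expansion n f s \<longleftrightarrow> (\<forall>x\<in>cube n. f x = mpoly_eval n s x)"

text \<open>Extensionality makes the coefficient family unique as a function on all sets;
  existence and uniqueness are proved in \<open>expansion_ex1\<close> below.\<close>
definition expansion_coeffs :: "nat \<Rightarrow> ((nat \<Rightarrow> real) \<Rightarrow> real) \<Rightarrow> nat set \<Rightarrow> real" where
  "expansion_coeffs n f = (THE s. s \<in> extensional (Pow {1..n}) \<and> is_expansion n f s)"

definition walsh_coeff :: "nat \<Rightarrow> ((nat \<Rightarrow> real) \<Rightarrow> real) \<Rightarrow> nat set \<Rightarrow> real" where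
  "walsh_coeff n f S = 2 ^ n * expansion_coeffs n f S"

definition bent :: "nat \<Rightarrow> ((nat \<Rightarrow> real) \<Rightarrow> real) \<Rightarrow> bool" where
  "bent n f \<longleftrightarrow> boolean_function n f \<and>
     (\<forall>S\<in>Pow {1..n}. walsh_coeff n f S \<in> {- (2 powr (real n / 2)), 2 powr (real n / 2)})"

text \<open>As \<open>sgn 0 = 0\<close>, for a Boolean function this forces the polynomial to be non-zero on the cube.\<close>
definition is_ptf :: "nat \<Rightarrow> ((nat \<Rightarrow> real) \<Rightarrow> real) \<Rightarrow> (nat set \<Rightarrow> real) \<Rightarrow> bool" where
  "is_ptf n f w \<longleftrightarrow> (\<forall>x\<in>cube n. f x = sgn (mpoly_eval n w x))"

definition integer_coeffs :: "nat \<Rightarrow> (nat set \<Rightarrow> real) \<Rightarrow> bool" where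
  "integer_coeffs n w \<longleftrightarrow> (\<forall>S\<in>Pow {1..n}. w S \<in> \<int>)"

definition ptf_length :: "nat \<Rightarrow> (nat set \<Rightarrow> real) \<Rightarrow> nat" where
  "ptf_length n w = card {S \<in> Pow {1..n}. w S \<noteq> 0}"

definition ptf_weight :: "nat \<Rightarrow> (nat set \<Rightarrow> real) \<Rightarrow> real" where
  "ptf_weight n w = (\<Sum>S\<in>Pow {1..n}. \<bar>w S\<bar>)"

definition short_integer_ptfs :: "nat \<Rightarrow> ((nat \<Rightarrow> real) \<Rightarrow> real) \<Rightarrow> (nat set \<Rightarrow> real) set" where
  "short_integer_ptfs n f =
     {w. is_ptf n f w \<and> integer_coeffs n w \<and> real (ptf_length n w) \<le> 0.75 * 2 ^ n}"

lemma finite_cube: "finite (cube n)"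
  unfolding cube_def by (intro finite_PiE) auto

lemma cube_value: "x \<in> cube n \<Longrightarrow> k \<in> {1..n} \<Longrightarrow> x k = -1 \<or> x k = 1"
  unfolding cube_def by (auto simp: PiE_iff)

lemma sum_characters_points:
  assumes "x \<in> cube n" "y \<in> cube n"
  shows "(\<Sum>S\<in>Pow {1..n}. (\<Prod>k\<in>S. x k) * (\<Prod>k\<in>S. y k)) = (if x = y then 2 ^ n else 0)"
proof -
  have "(\<Sum>S\<in>Pow {1..n}. (\<Prod>k\<in>S. x k) * (\<Prod>k\<in>S. y k)) = (\<Prod>k\<in>{1..n}. x k * y k + 1)"
    by (subst prod_add) (simp_all add: prod.distrib)
  also have "\<dots> = (if x = y then 2 ^ n else 0)"
  proof (cases "x = y")
    case True
    have "x k * y k + 1 = 2" if "k \<in> {1..n}" for k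
      using cube_value[OF assms(1) that] True by auto
    then have "(\<Prod>k\<in>{1..n}. x k * y k + 1) = (\<Prod>k\<in>{1..n}. 2)"
      by (rule prod.cong[OF refl])
    then show ?thesis using True by simp
  next
    case False
    then obtain k where k: "k \<in> {1..n}" "x k \<noteq> y k"
      using assms unfolding cube_def by (meson PiE_ext)
    have "x k * y k + 1 = 0"
      using cube_value[OF assms(1) k(1)] cube_value[OF assms(2) k(1)] k(2) by auto
    then show ?thesis using False k(1) by (auto intro!: prod_zero)
  qed
  finally show ?thesis .
qed

lemma sum_characters_sets:
  assumes "S \<subseteq> {1..n}" "T \<subseteq> {1..n}"
  shows "(\<Sum>x\<in>cube n. (\<Prod>k\<in>S. x k) * (\<Prod>k\<in>T. x k)) = (if S = T then 2 ^ n else 0)"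
proof -
  define g :: "nat \<Rightarrow> real \<Rightarrow> real"
    where "g k v = (if k \<in> S then v else 1) * (if k \<in> T then v else 1)" for k v
  have prod_restrict: "(\<Prod>k\<in>U. x k) = (\<Prod>k\<in>{1..n}. if k \<in> U then x k else 1)"
    if "U \<subseteq> {1..n}" for U and x :: "nat \<Rightarrow> real"
    using that by (intro prod.mono_neutral_cong_left) auto
  have "(\<Sum>x\<in>cube n. (\<Prod>k\<in>S. x k) * (\<Prod>k\<in>T. x k)) = (\<Sum>x\<in>cube n. \<Prod>k\<in>{1..n}. g k (x k))"
    by (simp only: prod_restrict[OF assms(1)] prod_restrict[OF assms(2)] g_def prod.distrib)
  also have "\<dots> = (\<Prod>k\<in>{1..n}. \<Sum>v\<in>{-1, 1}. g k v)"
    unfolding cube_def by (rule prod_sum_PiE[symmetric]) auto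
  also have "\<dots> = (\<Prod>k\<in>{1..n}. if k \<in> S \<longleftrightarrow> k \<in> T then 2 else 0)"
    by (rule prod.cong) (auto simp: g_def)
  also have "\<dots> = (if S = T then 2 ^ n else 0)"
  proof (cases "S = T")
    case False
    then obtain k where "k \<in> {1..n}" "\<not> (k \<in> S \<longleftrightarrow> k \<in> T)" using assms by blast
    then show ?thesis using False by (auto intro!: prod_zero)
  qed simp
  finally show ?thesis .
qed

lemma expansion_coeff_formula:
  assumes "is_expansion n f s" "T \<subseteq> {1..n}"
  shows "2 ^ n * s T = (\<Sum>x\<in>cube n. f x * (\<Prod>k\<in>T. x k))"
proof -
  have "(\<Sum>x\<in>cube n. f x * (\<Prod>k\<in>T. x k))
      = (\<Sum>x\<in>cube n. \<Sum>S\<in>Pow {1..n}. s S * ((\<Prod>k\<in>S. x k) * (\<Prod>k\<in>T. x k)))"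
    using assms(1) unfolding is_expansion_def mpoly_eval_def
    by (intro sum.cong) (simp_all add: sum_distrib_right mult.assoc)
  also have "\<dots> = (\<Sum>S\<in>Pow {1..n}. s S * (\<Sum>x\<in>cube n. (\<Prod>k\<in>S. x k) * (\<Prod>k\<in>T. x k)))"
    by (subst sum.swap) (simp add: sum_distrib_left)
  also have "\<dots> = (\<Sum>S\<in>Pow {1..n}. if S = T then s S * 2 ^ n else 0)"
    proof (rule sum.cong[OF refl])
    fix S assume "S \<in> Pow {1..n}"
    then show "s S * (\<Sum>x\<in>cube n. (\<Prod>k\<in>S. x k) * (\<Prod>k\<in>T. x k)) = (if S = T then s S * 2 ^ n else 0)"
      using sum_characters_sets[of S n T] assms(2) by simp
  qed
  also have "\<dots> = 2 ^ n * s T"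
    using assms(2) by (simp add: mult.commute)
  finally show ?thesis by simp
qed

lemma expansion_exists:
  "is_expansion n f (restrict (\<lambda>S. (\<Sum>x\<in>cube n. f x * (\<Prod>k\<in>S. x k)) / 2 ^ n) (Pow {1..n}))"
  unfolding is_expansion_def
proof
  fix y assume y: "y \<in> cube n"
  let ?s = "\<lambda>S. (\<Sum>x\<in>cube n. f x * (\<Prod>k\<in>S. x k)) / 2 ^ n"
  have "mpoly_eval n (restrict ?s (Pow {1..n})) y
      = (\<Sum>S\<in>Pow {1..n}. \<Sum>x\<in>cube n. f x / 2 ^ n * ((\<Prod>k\<in>S. x k) * (\<Prod>k\<in>S. y k)))"
    unfolding mpoly_eval_def
    by (intro sum.cong) (simp_all add: sum_divide_distrib sum_distrib_right mult.assoc)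
  also have "\<dots> = (\<Sum>x\<in>cube n. f x / 2 ^ n * (\<Sum>S\<in>Pow {1..n}. (\<Prod>k\<in>S. x k) * (\<Prod>k\<in>S. y k)))"
    by (subst sum.swap) (simp add: sum_distrib_left)
  also have "\<dots> = (\<Sum>x\<in>cube n. if x = y then f x else 0)"
    proof (rule sum.cong[OF refl])
    fix x assume "x \<in> cube n"
    then show "f x / 2 ^ n * (\<Sum>S\<in>Pow {1..n}. (\<Prod>k\<in>S. x k) * (\<Prod>k\<in>S. y k)) = (if x = y then f x else 0)"
      by (simp only: sum_characters_points[OF _ y]) simp
  qed
  also have "\<dots> = f y"
    using y by (simp add: finite_cube)
  finally show "f y = mpoly_eval n (restrict ?s (Pow {1..n})) y" by simp
qed

lemma expansion_ex1: "\<exists>!s. s \<in> extensional (Pow {1..n}) \<and> is_expansion n f s"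
proof (rule ex_ex1I)
  show "\<exists>s. s \<in> extensional (Pow {1..n}) \<and> is_expansion n f s"
    using expansion_exists by (meson restrict_extensional)
next
  fix s t
  assume "s \<in> extensional (Pow {1..n}) \<and> is_expansion n f s"
    and "t \<in> extensional (Pow {1..n}) \<and> is_expansion n f t"
  then have ext: "s \<in> extensional (Pow {1..n})" "t \<in> extensional (Pow {1..n})"
    and exp: "is_expansion n f s" "is_expansion n f t" by auto
  show "s = t"
  proof (rule extensionalityI[OF ext])
    fix T assume "T \<in> Pow {1..n}"
    then have "2 ^ n * s T = 2 ^ n * t T"
      using expansion_coeff_formula[OF exp(1)] expansion_coeff_formula[OF exp(2)] by simp
    then show "s T = t T" by simp
  qed
qed

lemma walsh_coeff_eq:
  assumes "S \<subseteq> {1..n}"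
  shows "walsh_coeff n f S = (\<Sum>x\<in>cube n. f x * (\<Prod>k\<in>S. x k))"
  using theI'[OF expansion_ex1, of n f] expansion_coeff_formula[OF _ assms]
  unfolding walsh_coeff_def expansion_coeffs_def by blast

end

theory Submission
  imports Defs
begin

text \<open>
  Let \<open>h S = \<plusminus>1\<close> be the normalised Walsh coefficients, so that \<open>2\<^sup>n\<^sup>/\<^sup>2 f = \<Sum> h S \<chi>\<^sub>S\<close>. Pair every
  \<open>S\<close> not containing \<open>1\<close> with \<open>S \<union> {1}\<close>. For a sign \<open>\<epsilon>\<close>, let \<open>A\<close> collect the terms \<open>h S \<chi>\<^sub>S\<close>
  with \<open>1 \<notin> S\<close> and \<open>h (S \<union> {1}) = \<epsilon> h S\<close>, and \<open>B\<close> the other terms with \<open>1 \<notin> S\<close>; then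
  \<open>2\<^sup>n\<^sup>/\<^sup>2 f = (1 + \<epsilon> x\<^sub>1) A + (1 - \<epsilon> x\<^sub>1) B\<close>. The polynomial \<open>p = N (1 + \<epsilon> x\<^sub>1) A + B\<close> equals
  \<open>2\<^sup>n\<^sup>/\<^sup>2 f / 2\<close> where \<open>\<epsilon> x\<^sub>1 = -1\<close> and \<open>N 2\<^sup>n\<^sup>/\<^sup>2 f + B\<close> where \<open>\<epsilon> x\<^sub>1 = 1\<close>, hence has the sign
  of \<open>f\<close> as soon as \<open>N > 2\<^sup>n\<^sup>-\<^sup>1 \<ge> \<bar>B\<bar>\<close>. It has one zero coefficient for each term of \<open>B\<close>, and for one
  of the two choices of \<open>\<epsilon>\<close> these are at least half of the \<open>2\<^sup>n\<^sup>-\<^sup>1\<close> pairs.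
\<close>

text \<open>With \<open>a = 1\<close> and \<open>A = {2..n}\<close> this turns every sum over
  coefficients into a sum over the pairs \<open>S\<close>, \<open>insert 1 S\<close>.\<close>

lemma sum_Pow_insert:
  fixes g :: "'a set \<Rightarrow> 'b::comm_monoid_add"
  assumes "finite A" "a \<notin> A"
  shows "sum g (Pow (insert a A)) = (\<Sum>S\<in>Pow A. g S + g (insert a S))"
proof -
  have inj: "inj_on (insert a) (Pow A)"
    using assms(2) by (intro inj_onI) (metis PowD insert_ident subsetD)
  have "sum g (Pow (insert a A)) = sum g (Pow A) + sum g (insert a ` Pow A)"
    unfolding Pow_insert using assms by (intro sum.union_disjoint) auto
  also have "sum g (insert a ` Pow A) = (\<Sum>S\<in>Pow A. g (insert a S))"
    by (simp add: sum.reindex[OF inj])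
  finally show ?thesis by (simp add: sum.distrib)
qed

lemma is_expansion_expansion_coeffs: "is_expansion n f (expansion_coeffs n f)"
  unfolding expansion_coeffs_def using theI'[OF expansion_ex1, of n f] by blast

text \<open>Because \<open>c * c = 2 ^ n\<close>, a Walsh coefficient is \<open>c\<close> times the
  coefficient of \<open>c * f\<close>; as the former is \<open>c\<close> or \<open>-c\<close>, the
  latter is a sign.\<close>

lemma bent_scaled_expansion:
  assumes "bent n f"
  obtains h where "\<And>S. S \<in> Pow {1..n} \<Longrightarrow> h S \<in> {-1, 1}"
    and "\<And>x. x \<in> cube n \<Longrightarrow> 2 powr (real n / 2) * f x = mpoly_eval n h x"
proof
  define c :: real where "c = 2 powr (real n / 2)"
  have c: "c > 0" "c * c = 2 ^ n"
    by (simp_all add: c_def flip: powr_add powr_realpow)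
  let ?h = "\<lambda>S. c * expansion_coeffs n f S"
  show "?h S \<in> {-1, 1}" if "S \<in> Pow {1..n}" for S
  proof -
    have "walsh_coeff n f S = - c \<or> walsh_coeff n f S = c"
      using assms that unfolding bent_def c_def by blast
    moreover have "walsh_coeff n f S = c * ?h S"
      by (simp add: walsh_coeff_def flip: c(2))
    ultimately have "c * ?h S = c * -1 \<or> c * ?h S = c * 1" by simp
    then show ?thesis using c(1) by (simp only: mult_cancel_left) auto
  qed
  show "2 powr (real n / 2) * f x = mpoly_eval n ?h x" if "x \<in> cube n" for x
    using is_expansion_expansion_coeffs[of n f] that
    unfolding is_expansion_def mpoly_eval_def c_def
    by (simp add: sum_distrib_left mult.assoc)
qed

lemma integer_coeffs_weight_Nats:
  assumes "integer_coeffs n w"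
  shows "ptf_weight n w \<in> \<nat>"
proof -
  have "ptf_weight n w \<in> \<int>"
    using assms unfolding ptf_weight_def integer_coeffs_def by (intro Ints_sum) simp
  moreover have "ptf_weight n w \<ge> 0"
    unfolding ptf_weight_def by (simp add: sum_nonneg)
  ultimately show ?thesis by (simp add: Nats_altdef2)
qed

text \<open>Integer coefficients make the weight a natural number, so well-ordering yields a
  minimum. The rounding \<open>nat \<lfloor>...\<rfloor>\<close> loses nothing and only changes the
  type.\<close>

lemma minimal_weight_ptf_exists:
  assumes "w \<in> short_integer_ptfs n f"
  obtains v where "v \<in> short_integer_ptfs n f"
    and "\<And>w'. w' \<in> short_integer_ptfs n f \<Longrightarrow> ptf_weight n v \<le> ptf_weight n w'"
proof -
  have weight: "real (nat \<lfloor>ptf_weight n u\<rfloor>) = ptf_weight n u" if "u \<in> short_integer_ptfs n f" for u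
    using that integer_coeffs_weight_Nats[of n u]
    by (auto simp: short_integer_ptfs_def elim: Nats_cases)
  obtain v where v: "v \<in> short_integer_ptfs n f"
    and least: "\<forall>u. u \<in> short_integer_ptfs n f \<longrightarrow> nat \<lfloor>ptf_weight n v\<rfloor> \<le> nat \<lfloor>ptf_weight n u\<rfloor>"
    using ex_has_least_nat[of "\<lambda>u. u \<in> short_integer_ptfs n f" w "\<lambda>u. nat \<lfloor>ptf_weight n u\<rfloor>"] assms
    by blast
  show thesis
  proof
    show "v \<in> short_integer_ptfs n f" by (fact v)
    fix u assume u: "u \<in> short_integer_ptfs n f"
    then have "real (nat \<lfloor>ptf_weight n v\<rfloor>) \<le> real (nat \<lfloor>ptf_weight n u\<rfloor>)"
      using least by simp
    then show "ptf_weight n v \<le> ptf_weight n u"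
      by (simp only: weight[OF v] weight[OF u])
  qed
qed

text \<open>Since \<open>h\<close> has no zero on \<open>R\<close>, the sets for
  \<open>e = 1\<close> and \<open>e = -1\<close> are disjoint, so they cannot both fill more than
  half of \<open>R\<close>.\<close>

lemma minority_sign:
  fixes h k :: "'a \<Rightarrow> real"
  assumes "finite R" "\<And>S. S \<in> R \<Longrightarrow> h S \<in> {-1, 1}"
  obtains e where "e \<in> {-1, 1}" "2 * card {S \<in> R. k S = e * h S} \<le> card R"
proof -
  have nz: "h S \<noteq> 0" if "S \<in> R" for S
    using assms(2)[OF that] by auto
  have "card {S \<in> R. k S = 1 * h S} + card {S \<in> R. k S = -1 * h S}
      = card ({S \<in> R. k S = 1 * h S} \<union> {S \<in> R. k S = -1 * h S})"
    using assms(1) by (intro card_Un_disjoint[symmetric]) (auto dest: nz)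
  also have "\<dots> \<le> card R"
    using assms(1) by (intro card_mono) auto
  finally have "2 * card {S \<in> R. k S = 1 * h S} \<le> card R \<or> 2 * card {S \<in> R. k S = -1 * h S} \<le> card R"
    by linarith
  then show thesis using that by blast
qed

lemma bent_light_short_ptf:
  assumes "n \<ge> 1" and bent: "bent n f"
  obtains w where "w \<in> short_integer_ptfs n f" "ptf_weight n w \<le> 0.75 * 2 ^ (2 * n)"
proof -
  define c :: real where "c = 2 powr (real n / 2)"
  have c: "c \<ge> 1" unfolding c_def by (rule ge_one_powr_ge_zero) auto
  obtain h where h: "\<And>S. S \<in> Pow {1..n} \<Longrightarrow> h S \<in> {-1, 1}"
    and fh: "\<And>x. x \<in> cube n \<Longrightarrow> c * f x = mpoly_eval n h x"
    using bent_scaled_expansion[OF bent] unfolding c_def by blast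
  define R where "R = Pow {2..n}"
  have "{1..n} = insert 1 {2..n}" using assms(1) by auto
  then have split: "sum g (Pow {1..n}) = (\<Sum>S\<in>R. g S + g (insert 1 S))" for g :: "nat set \<Rightarrow> real"
    using sum_Pow_insert[of "{2..n}" 1 g] by (simp add: R_def)
  have finR: "finite R" by (simp add: R_def)
  have R1: "1 \<notin> S" "finite S" "S \<in> Pow {1..n}" "insert 1 S \<in> Pow {1..n}" if "S \<in> R" for S
    using that assms(1) finite_subset[of S "{2..n}"] by (auto simp: R_def)
  have cardR: "2 * real (card R) = 2 ^ n"
    using assms(1) by (simp add: R_def card_Pow flip: power_Suc)
  have hR: "h S \<in> {-1, 1}" "h (insert 1 S) \<in> {-1, 1}" if "S \<in> R" for S
    using h R1 that by blast+
  obtain e where e: "e \<in> {-1, 1}"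
    and "2 * card {S \<in> R. h (insert 1 S) = e * h S} \<le> card R"
    by (rule minority_sign[where R = R and h = h and k = "\<lambda>S. h (insert 1 S)", OF finR hR(1)])
  define E where "E = {S \<in> R. h (insert 1 S) = e * h S}"
  have E: "E \<subseteq> R" "finite E" by (auto simp: E_def finR)
  have "2 * card E \<le> card R" unfolding E_def by fact
  then have cardE: "2 * real (card E) \<le> real (card R)" by linarith
  \<comment> \<open>Both values are signs, so failing to equal \<open>e * h S\<close> means
    equalling its negative.\<close>
  have neg: "h (insert 1 S) = - e * h S" if "S \<in> R - E" for S
    using that hR[of S] e by (auto simp: E_def)
  have pos: "h (insert 1 S) = e * h S" if "S \<in> E" for S
    using that by (simp add: E_def)
  define N :: real where "N = 2 ^ n"
  \<comment> \<open>\<open>S - {1}\<close> is the representative in \<open>R\<close> of the pair of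
    \<open>S\<close>. Pairs in \<open>E\<close> keep both terms, scaled by \<open>N\<close>; any
    other pair keeps only its member without 1.\<close>
  define w where "w S = (if S - {1} \<in> E then N * h S else if S \<in> R then h S else 0)" for S
  have w1: "w S = N * h S" "w (insert 1 S) = N * h (insert 1 S)" if "S \<in> E" for S
    using that E R1(1)[of S] by (auto simp: w_def)
  have w2: "w S = h S" "w (insert 1 S) = 0" if "S \<in> R - E" for S
    using that R1(1)[of S] R1(1)[of "insert 1 S"] by (auto simp: w_def)
  have splitE: "sum g R = sum g E + sum g (R - E)" for g :: "nat set \<Rightarrow> real"
    using sum.subset_diff[OF E(1) finR, of g] by simp
  have N: "N = 2 * real (card R)" "N \<ge> 2"
    using cardR assms(1) power_increasing[of 1 n "2::real"] by (auto simp: N_def)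

  have "is_ptf n f w"
    unfolding is_ptf_def
  proof
    fix x assume x: "x \<in> cube n"
    define A where "A = (\<Sum>S\<in>E. h S * (\<Prod>k\<in>S. x k))"
    define B where "B = (\<Sum>S\<in>R - E. h S * (\<Prod>k\<in>S. x k))"
    have x1: "x 1 \<in> {-1, 1}" using cube_value[OF x, of 1] assms(1) by auto
    have chi: "(\<Prod>k\<in>insert 1 S. x k) = x 1 * (\<Prod>k\<in>S. x k)" if "S \<in> R" for S
      using R1[OF that] by (subst prod.insert) auto
    have fAB: "c * f x = (1 + e * x 1) * A + (1 - e * x 1) * B"
    proof -
      have "c * f x = (\<Sum>S\<in>R. h S * (\<Prod>k\<in>S. x k) + h (insert 1 S) * (x 1 * (\<Prod>k\<in>S. x k)))"
        unfolding fh[OF x] mpoly_eval_def split by (intro sum.cong) (simp_all only: chi)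
      also have "\<dots> = (\<Sum>S\<in>E. (1 + e * x 1) * (h S * (\<Prod>k\<in>S. x k)))
          + (\<Sum>S\<in>R - E. (1 - e * x 1) * (h S * (\<Prod>k\<in>S. x k)))"
        unfolding splitE by (intro arg_cong2[where f = "(+)"] sum.cong refl)
          (simp_all only: pos neg, simp_all add: algebra_simps)
      finally show ?thesis by (simp add: A_def B_def sum_distrib_left)
    qed
    have pAB: "mpoly_eval n w x = N * (1 + e * x 1) * A + B"
    proof -
      have "mpoly_eval n w x = (\<Sum>S\<in>R. w S * (\<Prod>k\<in>S. x k) + w (insert 1 S) * (x 1 * (\<Prod>k\<in>S. x k)))"
        unfolding mpoly_eval_def split by (intro sum.cong) (simp_all only: chi)
      also have "\<dots> = (\<Sum>S\<in>E. N * (1 + e * x 1) * (h S * (\<Prod>k\<in>S. x k)))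
          + (\<Sum>S\<in>R - E. h S * (\<Prod>k\<in>S. x k))"
        unfolding splitE by (intro arg_cong2[where f = "(+)"] sum.cong refl)
          (simp_all only: w1 w2 pos, simp_all add: algebra_simps)
      finally show ?thesis by (simp add: A_def B_def sum_distrib_left)
    qed
    have "\<bar>B\<bar> \<le> (\<Sum>S\<in>R - E. 1)"
      unfolding B_def
    proof (rule order.trans[OF sum_abs sum_mono])
      fix S assume S: "S \<in> R - E"
      have "\<bar>x k\<bar> = 1" if "k \<in> S" for k
      proof -
        have "k \<in> {1..n}" using S R1(3)[of S] that by blast
        then show ?thesis using cube_value[OF x, of k] by auto
      qed
      then show "\<bar>h S * (\<Prod>k\<in>S. x k)\<bar> \<le> 1"
        using hR(1)[of S] S by (auto simp: abs_mult abs_prod)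
    qed
    also have "\<dots> \<le> real (card R)"
      using finR by (simp add: card_mono)
    finally have "\<bar>B\<bar> < N" using N by linarith
    \<comment> \<open>Where \<open>e * x 1 = 1\<close>, the main term \<open>N * (c * f x)\<close>
      has absolute value \<open>N * c\<close>; \<open>B\<close> must stay below that to leave the
      sign alone.\<close>
    moreover have "N * 1 \<le> N * c" using c N(2) by (intro mult_left_mono) auto
    ultimately have B: "\<bar>B\<bar> < N * c" by linarith
    have f: "f x \<in> {-1, 1}" using bent x by (auto simp: bent_def boolean_function_def)
    have "e * x 1 = 1 \<or> e * x 1 = -1" using e x1 by auto
    then show "f x = sgn (mpoly_eval n w x)"
    proof
      assume ex: "e * x 1 = 1"
      then have "mpoly_eval n w x = N * (c * f x) + B" using fAB pAB by simp
      then show ?thesis using f B by (auto simp: sgn_if abs_less_iff)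
    next
      \<comment> \<open>Here \<open>A\<close> drops out of both identities, leaving
        \<open>c * f x = 2 * B\<close> and the polynomial equal to \<open>B\<close>.\<close>
      assume ex: "e * x 1 = -1"
      then have "2 * mpoly_eval n w x = c * f x" using fAB pAB by simp
      then show ?thesis using f c by (auto simp: sgn_if)
    qed
  qed
  moreover have "integer_coeffs n w"
    unfolding integer_coeffs_def
  proof
    fix S assume "S \<in> Pow {1..n}"
    then have "h S \<in> \<int>" using h[of S] by auto
    then show "w S \<in> \<int>" by (simp add: w_def N_def)
  qed
  moreover have "real (ptf_length n w) \<le> 0.75 * 2 ^ n"
  proof -
    have "real (ptf_length n w) = (\<Sum>S\<in>Pow {1..n}. if w S \<noteq> 0 then 1 else 0)"
      unfolding ptf_length_def by (simp add: sum.If_cases Int_def)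
    \<comment> \<open>A pair in \<open>E\<close> has at most two non-zero coefficients, any other
      pair at most one. As \<open>E\<close> is at most half of \<open>R\<close>, the total is at
      most 3/2 of \<open>card R\<close>, which is 3/4 of \<open>2 ^ n\<close>.\<close>
    also have "\<dots> \<le> (\<Sum>S\<in>E. 2) + (\<Sum>S\<in>R - E. 1)"
      unfolding split splitE by (intro add_mono sum_mono) (simp_all only: w2, simp_all)
    also have "\<dots> = real (card R) + real (card E)"
      using E finR by (simp add: card_Diff_subset card_mono of_nat_diff)
    finally show ?thesis using cardE cardR by simp
  qed
  ultimately have w: "w \<in> short_integer_ptfs n f" by (simp add: short_integer_ptfs_def)
  have "ptf_weight n w = (\<Sum>S\<in>E. 2 * N) + (\<Sum>S\<in>R - E. 1)"
    unfolding ptf_weight_def split splitE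
  proof (intro arg_cong2[where f = "(+)"] sum.cong refl)
    show "\<bar>w S\<bar> + \<bar>w (insert 1 S)\<bar> = 2 * N" if "S \<in> E" for S
      using hR[OF subsetD[OF E(1) that]] N(2) w1[OF that] by (auto simp: abs_mult)
    show "\<bar>w S\<bar> + \<bar>w (insert 1 S)\<bar> = 1" if "S \<in> R - E" for S
      using hR[of S] that w2[OF that] by auto
  qed
  also have "\<dots> = 2 * real (card E) * N + real (card (R - E))" by simp
  also have "\<dots> \<le> real (card R) * N + real (card R)"
    using cardE N(2) finR by (intro add_mono mult_right_mono) (auto intro: card_mono)
  also have "\<dots> = N * N / 2 + N / 2" using N(1) by simp
  \<comment> \<open>From \<open>N \<ge> 2\<close> follows \<open>N / 2 \<le> N * N / 4\<close>, and
    1/2 + 1/4 is the constant 0.75.\<close>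
  also have "\<dots> \<le> 0.75 * (N * N)"
    using mult_right_mono[OF N(2), of N] N(2) by simp
  also have "N * N = 2 ^ (2 * n)" by (simp add: N_def mult_2 power_add)
  finally show thesis using that w by blast
qed

theorem mainTheorem4:
  fixes n :: nat and f :: "(nat \<Rightarrow> real) \<Rightarrow> real"
  assumes "n \<ge> 1" and "bent n f"
  shows "\<exists>w\<in>short_integer_ptfs n f.
           (\<forall>w'\<in>short_integer_ptfs n f. ptf_weight n w \<le> ptf_weight n w') \<and>
           ptf_weight n w \<le> 0.75 * 2 ^ (2 * n)"
proof -
  obtain w where w: "w \<in> short_integer_ptfs n f" "ptf_weight n w \<le> 0.75 * 2 ^ (2 * n)"
    using bent_light_short_ptf[OF assms] by blast
  obtain v where v: "v \<in> short_integer_ptfs n f"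
    "\<And>w'. w' \<in> short_integer_ptfs n f \<Longrightarrow> ptf_weight n v \<le> ptf_weight n w'"
    using minimal_weight_ptf_exists[OF w(1)] by blast
  show ?thesis using v v(2)[OF w(1)] w(2) by (meson order.trans)
qed

end
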